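(* Let $r=O(1)$ be a constant. Let $(\mathit{Init},\delta,\mathit{Bad})$ be a transition system over $n$ Boolean variables and $k\in\mathbb{N}$. If there exists an inductive invariant $I$ that is backwards $k$-fenced, and $I$ is an $r$-almost-monotone DNF formula with $m$ terms, then $\Lambda$-Inference$(\mathit{Init},\delta,\mathit{Bad},k)$ with an appropriate basis (namely, the set of all translations that assign $\mathit{true}$ to at most $r$ variables) converges to an inductive invariant in $\mathrm{poly}(m\cdot n)$ inductiveness checks, $\mathrm{poly}(m\cdot n)$ $k$-BMC checks, and $\mathrm{poly}(m\cdot n)$ time.
   Context: Transition systems. $\Sigma=\{p_1,\dots,p_n\}$ is a finite set of Boolean variables; a state is a valuation $x$ of $\Sigma$, $x[p]$ is its value at $p$, and $x[p\mapsto z]$ is $x$ with $p$ reassigned to $z$; a formula over $\Sigma$ is identified with the set of states satisfying it, and $\varphi\Longrightarrow\psi$ means that $\varphi\to\psi$ is valid. A transition system is a triple $(\mathit{Init},\delta,\mathit{Bad})$ with $\mathit{Init},\mathit{Bad}$ formulas over $\Sigma$ and $\delta$ a formula over $\Sigma\uplus\Sigma'$ ($\Sigma'$ a primed copy), describing pairs (pre-state, post-state). Standing assumptions: $\mathit{Init}\not\equiv\mathit{false}$, $\mathit{Bad}\not\equiv\mathit{true},\mathit{false}$, $\mathit{Init}\Longrightarrow\neg\mathit{Bad}$. An inductive invariant is a formula $I$ over $\Sigma$ with (i) $\mathit{Init}\Longrightarrow I$, (ii) $I\wedge\delta\Longrightarrow I'$, (iii) $I\Longrightarrow\neg\mathit{Bad}$,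 where $I'$ is $I$ with variables primed. Bounded reachability. $\delta^{\le k}(S)$ is the set of states reachable from some state in $S$ in at most $k$ steps of $\delta$; $(\delta^{-1})^{\le k}(\mathit{Bad})$ is the set of states from which some state of $\mathit{Bad}$ is reachable in at most $k$ steps. Fence condition. Two states are neighbors if they differ in exactly one variable. $\partial^-(I)=\{\sigma\not\models I : \sigma \text{ has a neighbor } \models I\}$. An inductive invariant $I$ is backwards $k$-fenced if $\partial^-(I)\subseteq(\delta^{-1})^{\le k}(\mathit{Bad})$. A DNF formula (disjunction of terms, i.e. of conjunctions of literals) is $r$-almost-monotone if at most $r$ of its terms include negative literals. A translation is a valuation $a$ of $\Sigma$. The monotone cube of a state $v$ w.r.t. $a$, $\mathrm{cube}_a(v)$, is the conjunction of the literals over those $p_i$ with $v[p_i]\ne a[p_i]$ that hold in $v$. Algorithm $\Lambda$-Inference$(\mathit{Init},\delta,\mathit{Bad},k)$ with given translations $a_1,\dots,a_t$ (the "basis"): set $H_1,\dots,H_t\leftarrow\mathit{false}$. While $H=\bigwedge_{i=1}^t H_i$ is not an inductive invariant: take any state $\sigma'$ such that either $(\sigma,\sigma')\models H\wedge\delta\wedge\neg H'$ for some $\sigma$, or $\sigma'\models\mathit{Init}\wedge\neg H$; for each $i=1,\dots,t$ with $\sigma'\not\models H_i$, set $H_i\leftarrow H_i\vee d$ where $d=\mathrm{MonGenBmc}(\sigma',a_i)$. Return $\bigwedge_i H_i$. Procedure $\mathrm{MonGenBmc}(\sigma,a)$: if $\delta^{\le k}(\{\sigma\})\cap\mathit{Bad}\ne\emptyset$,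 the run with bound $k$ fails (restart with larger $k$). Otherwise let $v\leftarrow\sigma$ and repeat passes until a pass makes no change: in a pass, for $j=1,\dots,n$ with $a[p_j]\ne v[p_j]$, let $x=v[p_j\mapsto a[p_j]]$ and if $\delta^{\le k}(\{x\})\cap\mathit{Bad}=\emptyset$ set $v\leftarrow x$. Return $\mathrm{cube}_a(v)$. "Converges to an inductive invariant" means that, for every resolution of the arbitrary choices, it terminates without failing with bound $k$ and returns an inductive invariant. Complexity measure. An inductiveness check decides whether a candidate is an inductive invariant and returns a counterexample if not; a $k$-BMC check decides whether $\delta^{\le k}(\psi)\cap\mathit{Bad}=\emptyset$ or whether $\delta^{\le k}(\mathit{Init})\cap\psi=\emptyset$ for a given $\psi$. Time counts each such check (SAT oracle call) as one step. $\mathrm{poly}(m\cdot n)$ means bounded by a polynomial in $m\cdot n$, which may depend on the constant $r$. *)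

theory Defs
  imports Main "HOL-Computational_Algebra.Polynomial" "HOL-Library.Product_Plus"
begin

text \<open>The variables are numbered \<open>0, \<dots>, n - 1\<close>. States and translations are Boolean lists of
  length \<open>n\<close> (so that \<open>n\<close> is a number and can be quantified over), and
  \<open>x[p\<^sub>j \<mapsto> z]\<close> is the list update \<open>x[j := z]\<close>. A formula that only matters up to
  equivalence is the set of states satisfying it; DNF formulas are syntactic.\<close>

type_synonym state = "bool list"

definition states :: "nat \<Rightarrow> state set" where
  "states n = {v. length v = n}"

record transition_system =
  nvars :: nat
  init :: "state set"
  trans_rel :: "(state \<times> state) set"
  bad :: "state set"

definition is_transition_system :: "transition_system \<Rightarrow> bool" where
  "is_transition_system S \<longleftrightarrow>
     init S \<subseteq> states (nvars S) \<and>
     trans_rel S \<subseteq> states (nvars S) \<times> states (nvars S) \<and>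
     bad S \<subseteq> states (nvars S) \<and>
     init S \<noteq> {} \<and> bad S \<noteq> {} \<and> bad S \<noteq> states (nvars S) \<and>
     init S \<inter> bad S = {}"

definition inductive_invariant :: "transition_system \<Rightarrow> state set \<Rightarrow> bool" where
  "inductive_invariant S I \<longleftrightarrow>
     I \<subseteq> states (nvars S) \<and>
     init S \<subseteq> I \<and>
     (\<forall>x y. x \<in> I \<and> (x, y) \<in> trans_rel S \<longrightarrow> y \<in> I) \<and>
     I \<inter> bad S = {}"

definition reach_le :: "(state \<times> state) set \<Rightarrow> nat \<Rightarrow> state set \<Rightarrow> state set" where
  "reach_le R k X = (\<Union>i\<le>k. (R ^^ i) `` X)"

definition neighbors :: "nat \<Rightarrow> state \<Rightarrow> state \<Rightarrow> bool" where
  "neighbors n x y \<longleftrightarrow> x \<in> states n \<and> y \<in> states n \<and> card {j. j < n \<and> x ! j \<noteq> y ! j} = 1"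

definition outer_boundary :: "nat \<Rightarrow> state set \<Rightarrow> state set" where
  "outer_boundary n I = {x \<in> states n. x \<notin> I \<and> (\<exists>y\<in>I. neighbors n x y)}"

definition backwards_fenced :: "transition_system \<Rightarrow> nat \<Rightarrow> state set \<Rightarrow> bool" where
  "backwards_fenced S k I \<longleftrightarrow>
     outer_boundary (nvars S) I \<subseteq> reach_le ((trans_rel S)\<inverse>) k (bad S)"

datatype literal = Pos nat | Neg nat

type_synonym conjunct = "literal list"

type_synonym dnf = "conjunct list"

fun lit_var :: "literal \<Rightarrow> nat" where
  "lit_var (Pos j) = j"
| "lit_var (Neg j) = j"

fun lit_holds :: "state \<Rightarrow> literal \<Rightarrow> bool" where
  "lit_holds v (Pos j) \<longleftrightarrow> v ! j"
| "lit_holds v (Neg j) \<longleftrightarrow> \<not> v ! j"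

definition conjunct_holds :: "state \<Rightarrow> conjunct \<Rightarrow> bool" where
  "conjunct_holds v T \<longleftrightarrow> (\<forall>l\<in>set T. lit_holds v l)"

definition dnf_holds :: "state \<Rightarrow> dnf \<Rightarrow> bool" where
  "dnf_holds v F \<longleftrightarrow> (\<exists>T\<in>set F. conjunct_holds v T)"

definition dnf_over :: "nat \<Rightarrow> dnf \<Rightarrow> bool" where
  "dnf_over n F \<longleftrightarrow> (\<forall>T\<in>set F. \<forall>l\<in>set T. lit_var l < n)"

definition sat :: "nat \<Rightarrow> dnf \<Rightarrow> state set" where
  "sat n F = {v \<in> states n. dnf_holds v F}"

definition almost_monotone :: "nat \<Rightarrow> dnf \<Rightarrow> bool" where
  "almost_monotone r F \<longleftrightarrow> length (filter (\<lambda>T. \<exists>j. Neg j \<in> set T) F) \<le> r"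

definition dnf_size :: "dnf \<Rightarrow> nat" where
  "dnf_size F = (\<Sum>T\<leftarrow>F. 1 + length T)"

definition monotone_cube :: "state \<Rightarrow> state \<Rightarrow> conjunct" where
  "monotone_cube a v =
     map (\<lambda>j. if v ! j then Pos j else Neg j) (filter (\<lambda>j. v ! j \<noteq> a ! j) [0..<length v])"

definition sparse_translations :: "nat \<Rightarrow> nat \<Rightarrow> state set" where
  "sparse_translations n r = {a \<in> states n. card {j. j < n \<and> a ! j} \<le> r}"

text \<open>A cost is a triple (inductiveness checks, \<open>k\<close>-BMC checks, time), added componentwise.
  Each check takes one time step. Outside the checks, time is charged per elementary operation:
  reading, comparing or assigning one Boolean, traversing one connective or literal of a formula,
  copying one bit.\<close>

type_synonym cost = "nat \<times> nat \<times> nat"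

definition inductiveness_check :: cost where
  "inductiveness_check = (1, 0, 1)"

definition bmc_check :: cost where
  "bmc_check = (0, 1, 1)"

definition ticks :: "nat \<Rightarrow> cost" where
  "ticks t = (0, 0, t)"

definition bmc_safe :: "transition_system \<Rightarrow> nat \<Rightarrow> state \<Rightarrow> bool" where
  "bmc_safe S k x \<longleftrightarrow> reach_le (trans_rel S) k {x} \<inter> bad S = {}"

text \<open>In \<open>gen_step\<close>, the three ticks besides the check pay for comparing \<open>a[p\<^sub>j]\<close> with
  \<open>v[p\<^sub>j]\<close>, flipping \<open>p\<^sub>j\<close>, and recording or undoing the flip.\<close>

fun gen_step :: "transition_system \<Rightarrow> nat \<Rightarrow> state \<Rightarrow> nat \<Rightarrow> state \<times> cost \<Rightarrow> state \<times> cost" where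
  "gen_step S k a j (v, c) =
     (if a ! j = v ! j then (v, c + ticks 1)
      else let x = v[j := a ! j] in
        if bmc_safe S k x then (x, c + ticks 3 + bmc_check)
        else (v, c + ticks 3 + bmc_check))"

definition gen_pass :: "transition_system \<Rightarrow> nat \<Rightarrow> state \<Rightarrow> state \<times> cost \<Rightarrow> state \<times> cost" where
  "gen_pass S k a vc = fold (gen_step S k a) [0..<nvars S] vc"

definition disagreement :: "state \<Rightarrow> state \<Rightarrow> nat" where
  "disagreement a v = card {j. j < length v \<and> v ! j \<noteq> a ! j}"

lemma disagreement_flip:
  assumes "a ! i \<noteq> v ! i"
  shows "v[i := a ! i] = v \<or> disagreement a (v[i := a ! i]) < disagreement a v"
proof (cases "i < length v")
  case True
  have "{j. j < length (v[i := a ! i]) \<and> v[i := a ! i] ! j \<noteq> a ! j} \<subseteq>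
        {j. j < length v \<and> v ! j \<noteq> a ! j} - {i}"
    using True by (auto simp: nth_list_update split: if_splits)
  also have "\<dots> \<subset> {j. j < length v \<and> v ! j \<noteq> a ! j}"
    using assms True by auto
  finally show ?thesis
    unfolding disagreement_def by (intro disjI2 psubset_card_mono) simp_all
qed (simp add: list_update_beyond)

lemma gen_step_decreases:
  "fst (gen_step S k a i vc) = fst vc \<or>
   disagreement a (fst (gen_step S k a i vc)) < disagreement a (fst vc)"
  by (cases vc) (use disagreement_flip[of a i "fst vc"] in \<open>auto simp: Let_def\<close>)

lemma gen_fold_decreases:
  "fst (fold (gen_step S k a) js vc) = fst vc \<or>
   disagreement a (fst (fold (gen_step S k a) js vc)) < disagreement a (fst vc)"
proof (induction js arbitrary: vc)
  case (Cons i js)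
  from Cons.IH[of "gen_step S k a i vc"] gen_step_decreases[of S k a i vc]
  show ?case by (auto dest: less_trans)
qed simp

function gen_loop :: "transition_system \<Rightarrow> nat \<Rightarrow> state \<Rightarrow> state \<times> cost \<Rightarrow> state \<times> cost" where
  "gen_loop S k a (v, c) =
     (let (v', c') = gen_pass S k a (v, c) in
      if v' = v then (v', c' + ticks 1) else gen_loop S k a (v', c' + ticks 1))"
  by pat_completeness auto
termination
proof (relation "measure (\<lambda>(S, k, a, v, c). disagreement a v)", goal_cases)
  case 1
  show ?case by simp
next
  case (2 S k a v c x v' c')
  then have "v' = fst (fold (gen_step S k a) [0..<nvars S] (v, c))"
    unfolding gen_pass_def by (metis fst_conv)
  with gen_fold_decreases[of S k a "[0..<nvars S]" "(v, c)"] 2(3) show ?case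
    by simp
qed

text \<open>The result \<open>None\<close> means that the run with bound \<open>k\<close> fails.\<close>

definition mon_gen_bmc ::
  "transition_system \<Rightarrow> nat \<Rightarrow> state \<Rightarrow> state \<Rightarrow> conjunct option \<times> cost" where
  "mon_gen_bmc S k x a =
     (if \<not> bmc_safe S k x then (None, bmc_check)
      else let (v, c) = gen_loop S k a (x, bmc_check + ticks (nvars S))
           in (Some (monotone_cube a v), c + ticks (nvars S)))"

text \<open>The algorithm's data are the translations \<open>a\<^sub>i\<close>, each paired with its current \<open>H\<^sub>i\<close>.\<close>

type_synonym hypotheses = "(state \<times> dnf) list"

definition conj_sat :: "nat \<Rightarrow> dnf list \<Rightarrow> state set" where
  "conj_sat n Hs = {v \<in> states n. \<forall>H\<in>set Hs. dnf_holds v H}"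

text \<open>The loop body for a counterexample \<open>x\<close>; testing \<open>x\<close> against \<open>H\<^sub>i\<close> takes time linear in
  the size of \<open>H\<^sub>i\<close>.\<close>

fun add_cubes ::
  "transition_system \<Rightarrow> nat \<Rightarrow> state \<Rightarrow> hypotheses \<Rightarrow> hypotheses option \<times> cost" where
  "add_cubes S k x [] = (Some [], ticks 1)"
| "add_cubes S k x ((a, H) # Hs) =
     (let test = ticks (1 + dnf_size H);
          (res, c) = (if dnf_holds x H then (Some H, 0)
                      else let (d, c) = mon_gen_bmc S k x a
                           in (map_option (\<lambda>d. H @ [d]) d, c + ticks 1))
      in case res of
           None \<Rightarrow> (None, test + c)
         | Some H' \<Rightarrow>
             (let (rest, c') = add_cubes S k x Hs
              in (map_option (\<lambda>Hs'. (a, H') # Hs') rest, test + c + c')))"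

definition counterexamples :: "transition_system \<Rightarrow> state set \<Rightarrow> state set" where
  "counterexamples S H =
     {y. (\<exists>x. x \<in> H \<and> (x, y) \<in> trans_rel S \<and> y \<notin> H) \<or> (y \<in> init S \<and> y \<notin> H)}"

datatype config =
    Running hypotheses (config_cost: cost)
  | Failed (config_cost: cost)
  | Returned "dnf list" (config_cost: cost)

text \<open>One loop iteration: the candidate is assembled and submitted to a single inductiveness check,
  which also supplies the counterexample. If the candidate is not an inductive invariant but there
  is no counterexample (it only violates safety), the run is stuck in a \<open>Running\<close>
  configuration.\<close>

definition iteration_check :: "hypotheses \<Rightarrow> cost" where
  "iteration_check Hs = inductiveness_check + ticks (\<Sum>(a, H)\<leftarrow>Hs. 1 + dnf_size H)"

inductive lambda_step :: "transition_system \<Rightarrow> nat \<Rightarrow> config \<Rightarrow> config \<Rightarrow> bool"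
  for S :: transition_system and k :: nat where
  lambda_return:
    "inductive_invariant S (conj_sat (nvars S) (map snd Hs)) \<Longrightarrow>
     lambda_step S k (Running Hs c) (Returned (map snd Hs) (c + iteration_check Hs))"
| lambda_continue:
    "\<not> inductive_invariant S (conj_sat (nvars S) (map snd Hs)) \<Longrightarrow>
     x \<in> counterexamples S (conj_sat (nvars S) (map snd Hs)) \<Longrightarrow>
     add_cubes S k x Hs = (Some Hs', c') \<Longrightarrow>
     lambda_step S k (Running Hs c) (Running Hs' (c + iteration_check Hs + c'))"
| lambda_fail:
    "\<not> inductive_invariant S (conj_sat (nvars S) (map snd Hs)) \<Longrightarrow>
     x \<in> counterexamples S (conj_sat (nvars S) (map snd Hs)) \<Longrightarrow>
     add_cubes S k x Hs = (None, c') \<Longrightarrow>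
     lambda_step S k (Running Hs c) (Failed (c + iteration_check Hs + c'))"

definition lambda_start :: "state list \<Rightarrow> config" where
  "lambda_start as = Running (map (\<lambda>a. (a, [])) as) (ticks (length as))"

text \<open>The relation \<open>lambda_step\<close> is nondeterministic only in the choice of counterexamples;
  convergence is required for all choices.\<close>

definition lambda_converges :: "transition_system \<Rightarrow> nat \<Rightarrow> state list \<Rightarrow> bool" where
  "lambda_converges S k as \<longleftrightarrow>
     (\<nexists>f. f 0 = lambda_start as \<and> (\<forall>i. lambda_step S k (f i) (f (Suc i)))) \<and>
     (\<forall>cfg. (lambda_step S k)\<^sup>*\<^sup>* (lambda_start as) cfg \<and> (\<nexists>cfg'. lambda_step S k cfg cfg') \<longrightarrow>
        (\<exists>Hs c. cfg = Returned Hs c \<and> inductive_invariant S (conj_sat (nvars S) Hs)))"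

definition lambda_cost_bounded ::
  "transition_system \<Rightarrow> nat \<Rightarrow> state list \<Rightarrow> nat \<Rightarrow> nat \<Rightarrow> nat \<Rightarrow> bool" where
  "lambda_cost_bounded S k as b_ind b_bmc b_time \<longleftrightarrow>
     (\<forall>cfg n_ind n_bmc n_time.
        (lambda_step S k)\<^sup>*\<^sup>* (lambda_start as) cfg \<and> config_cost cfg = (n_ind, n_bmc, n_time) \<longrightarrow>
        n_ind \<le> b_ind \<and> n_bmc \<le> b_bmc \<and> n_time \<le> b_time)"

end

theory Submission imports Defs "HOL-Library.Product_Order" begin

text \<open>Let \<open>I\<close> be the fenced invariant. From a state of \<open>I\<close>, a single flip leads either into \<open>I\<close>,
  where bounded model checking succeeds because \<open>I\<close> is invariant, or into the outer boundary,
  where it fails by the fence condition. Started in \<open>I\<close>, the generalization procedure therefore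
  walks inside \<open>I\<close> and stops at a state of \<open>I\<close> that is locally closest to the translation. A DNF
  with \<open>m\<close> terms has at most \<open>m\<close> such states, since each one is determined by any term
  it satisfies. As every cube added to \<open>H\<^sub>i\<close> is new, \<open>H\<^sub>i\<close> is extended at most \<open>m\<close> times.

  Every \<open>H\<^sub>i\<close> stays below the monotone hull of \<open>I\<close> with respect to \<open>a\<^sub>i\<close>, and the conjunction of
  these hulls is \<open>I\<close>: for a state \<open>x\<close> outside \<open>I\<close>, let \<open>a\<close> be true at one variable for each
  nonmonotone term that \<open>x\<close> violates at a negative literal. Then every term of \<open>I\<close>
  has a literal violated by both \<open>x\<close> and \<open>a\<close>, so no state between \<open>a\<close> and \<open>x\<close> lies in \<open>I\<close>.
  Hence all counterexamples lie in \<open>I\<close>, and each of them extends some \<open>H\<^sub>i\<close>.\<close>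

text \<open>Makes the componentwise order on cost triples compatible with addition, so that cost
  bounds can be chained by monotonicity.\<close>

instance prod :: (ordered_ab_semigroup_add, ordered_ab_semigroup_add) ordered_ab_semigroup_add
  by standard (auto simp: less_eq_prod_def intro: add_left_mono)

section \<open>Locally closest states\<close>

lemma conjunct_holds_monotone_cube:
  "conjunct_holds x (monotone_cube a v) \<longleftrightarrow> (\<forall>j<length v. v ! j \<noteq> a ! j \<longrightarrow> x ! j = v ! j)"
  by (force simp: conjunct_holds_def monotone_cube_def)

lemma length_monotone_cube: "length (monotone_cube a v) \<le> length v"
  unfolding monotone_cube_def
  by (metis length_map length_filter_le length_upt minus_nat.diff_0)

text \<open>Minimality is with respect to single flips towards \<open>a\<close>, since
  generalization tries only one flip at a time.\<close>

definition local_minima :: "nat \<Rightarrow> state set \<Rightarrow> state \<Rightarrow> state set" where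
  "local_minima n I a = {v \<in> I. \<forall>j<n. v ! j \<noteq> a ! j \<longrightarrow> v[j := a ! j] \<notin> I}"

text \<open>A variable absent from \<open>T\<close> can be flipped without falsifying
  \<open>T\<close>, so minimality forces it to agree with \<open>a\<close>; \<open>T\<close> fixes
  all the others.\<close>

lemma local_minimum_determined_by_term:
  assumes v: "v \<in> local_minima n (sat n F) a" and T: "T \<in> set F" "conjunct_holds v T"
  shows "v = map (\<lambda>j. if Pos j \<in> set T then True else if Neg j \<in> set T then False else a ! j) [0..<n]"
proof (rule nth_equalityI)
  have len: "length v = n"
    using v by (auto simp: local_minima_def sat_def states_def)
  then show "length v = length (map (\<lambda>j. if Pos j \<in> set T then True
      else if Neg j \<in> set T then False else a ! j) [0..<n])"
    by simp
  fix j assume "j < length v"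
  then have j: "j < n" using len by simp
  have "v ! j = a ! j" if free: "Pos j \<notin> set T" "Neg j \<notin> set T"
  proof (rule ccontr)
    assume "v ! j \<noteq> a ! j"
    then have "v[j := a ! j] \<notin> sat n F"
      using v j by (auto simp: local_minima_def)
    moreover have "lit_holds (v[j := a ! j]) l" if "l \<in> set T" for l
    proof -
      have "lit_holds v l" "lit_var l \<noteq> j"
        using that T(2) free by (auto simp: conjunct_holds_def) (cases l; auto)
      then show ?thesis by (cases l) auto
    qed
    ultimately show False
      using T(1) len by (auto simp: sat_def states_def dnf_holds_def conjunct_holds_def)
  qed
  moreover have "v ! j" if "Pos j \<in> set T"
    using that T(2) by (force simp: conjunct_holds_def)
  moreover have "\<not> v ! j" if "Neg j \<in> set T"
    using that T(2) by (force simp: conjunct_holds_def)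
  ultimately show "v ! j = map (\<lambda>j. if Pos j \<in> set T then True
      else if Neg j \<in> set T then False else a ! j) [0..<n] ! j"
    using j by auto
qed

lemma
  shows finite_local_minima: "finite (local_minima n (sat n F) a)"
    and card_local_minima: "card (local_minima n (sat n F) a) \<le> length F"
proof -
  let ?w = "\<lambda>T. map (\<lambda>j. if Pos j \<in> set T then True else if Neg j \<in> set T then False else a ! j) [0..<n]"
  have sub: "local_minima n (sat n F) a \<subseteq> ?w ` set F"
  proof
    fix v assume v: "v \<in> local_minima n (sat n F) a"
    then obtain T where "T \<in> set F" "conjunct_holds v T"
      by (auto simp: local_minima_def sat_def dnf_holds_def)
    with local_minimum_determined_by_term[OF v] show "v \<in> ?w ` set F" by blast
  qed
  then show "finite (local_minima n (sat n F) a)"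
    by (rule finite_subset) simp
  have "card (local_minima n (sat n F) a) \<le> card (?w ` set F)"
    using sub by (intro card_mono) auto
  also have "\<dots> \<le> length F"
    by (meson card_image_le card_length finite_set le_trans)
  finally show "card (local_minima n (sat n F) a) \<le> length F" .
qed

section \<open>Sparse translations\<close>

text \<open>Serves to show that candidates reject every state outside the invariant: one sparse
  \<open>a\<close> rules out all cubes at once.\<close>

lemma sparse_separation:
  assumes F: "dnf_over n F" "almost_monotone r F" and x: "x \<in> states n" "x \<notin> sat n F"
  shows "\<exists>a\<in>sparse_translations n r. \<forall>v\<in>sat n F. \<not> conjunct_holds x (monotone_cube a v)"
proof -
  define G where "G = {T \<in> set F. \<exists>j. Neg j \<in> set T}"
  \<comment> \<open>One variable per term that \<open>x\<close> violates at a negative literal is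
    enough, which keeps \<open>A\<close> within \<open>r\<close> elements.\<close>
  define f where "f T = (SOME j. Neg j \<in> set T \<and> x ! j)" for T
  define A where "A = f ` {T \<in> G. \<exists>j. Neg j \<in> set T \<and> x ! j}"
  define a where "a = map (\<lambda>j. j \<in> A) [0..<n]"
  have f: "Neg (f T) \<in> set T \<and> x ! f T" if "\<exists>j. Neg j \<in> set T \<and> x ! j" for T
    using someI_ex[OF that] by (simp add: f_def)
  have "finite G" by (simp add: G_def)
  have "G = set (filter (\<lambda>T. \<exists>j. Neg j \<in> set T) F)"
    by (auto simp: G_def)
  then have "card G \<le> length (filter (\<lambda>T. \<exists>j. Neg j \<in> set T) F)"
    by (simp only: card_length)
  with F(2) have "card G \<le> r" by (simp add: almost_monotone_def)
  moreover have "card A \<le> card G"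
    using \<open>finite G\<close> by (rule surj_card_le) (auto simp: A_def)
  moreover have "card {j. j < n \<and> a ! j} \<le> card A"
    using \<open>finite G\<close> by (intro card_mono) (auto simp: a_def A_def)
  ultimately have a: "a \<in> sparse_translations n r"
    by (simp add: sparse_translations_def states_def a_def)
  have "\<not> conjunct_holds x (monotone_cube a v)" if v: "v \<in> sat n F" for v
  proof
    assume cube: "conjunct_holds x (monotone_cube a v)"
    obtain T where T: "T \<in> set F" "conjunct_holds v T"
      using v by (auto simp: sat_def dnf_holds_def)
    have len: "length v = n" using v by (simp add: sat_def states_def)
    have lt: "lit_var l < n" if "l \<in> set T" for l
      using F(1) T(1) that by (auto simp: dnf_over_def)
    have eq: "v ! j = a ! j \<or> v ! j = x ! j" if "j < n" for j
      using cube that len by (auto simp: conjunct_holds_monotone_cube)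
    obtain l where l: "l \<in> set T" "\<not> lit_holds x l"
      using x T(1) by (auto simp: sat_def dnf_holds_def conjunct_holds_def)
    show False
    proof (cases l)
      case (Pos j)
      \<comment> \<open>\<open>x\<close> is true on all of \<open>A\<close> but false at
        \<open>j\<close>, so \<open>a\<close> is false at \<open>j\<close> too.\<close>
      have "j \<notin> A" using l(2) Pos f by (auto simp: A_def)
      then show False
        using eq[of j] lt[OF l(1)] l T(2) Pos by (force simp: conjunct_holds_def a_def)
    next
      case (Neg j)
      \<comment> \<open>\<open>a\<close> is true at the chosen variable \<open>f T\<close>, not
        necessarily at \<open>j\<close>, so the contradiction is drawn at
        \<open>f T\<close>.\<close>
      then have ex: "\<exists>j. Neg j \<in> set T \<and> x ! j" using l by auto
      then have "f T \<in> A" using T(1) by (auto simp: A_def G_def)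
      moreover have "f T < n" using f[OF ex] lt by force
      moreover have "\<not> v ! f T" using f[OF ex] T(2) by (force simp: conjunct_holds_def)
      ultimately show False using eq[of "f T"] f[OF ex] by (simp add: a_def)
    qed
  qed
  with a show ?thesis by blast
qed

lemma card_sparse_translations: "card (sparse_translations n r) \<le> (n + 1) ^ r"
proof -
  let ?L = "{xs. set xs \<subseteq> {..n} \<and> length xs = r}"
  let ?h = "\<lambda>xs. map (\<lambda>j. j \<in> set xs) [0..<n]"
  have "sparse_translations n r \<subseteq> ?h ` ?L"
  proof
    fix a assume a: "a \<in> sparse_translations n r"
    define A where "A = {j. j < n \<and> a ! j}"
    have A: "finite A" "card A \<le> r" "length a = n"
      using a by (auto simp: A_def sparse_translations_def states_def)
    \<comment> \<open>The padding value \<open>n\<close> is not a variable: it brings every list to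
      length \<open>r\<close> and vanishes on decoding.\<close>
    define xs where "xs = sorted_list_of_set A @ replicate (r - card A) n"
    have "xs \<in> ?L"
      using A by (auto simp: xs_def A_def)
    moreover have "a = ?h xs"
      using A by (intro nth_equalityI) (auto simp: xs_def A_def)
    ultimately show "a \<in> ?h ` ?L" by blast
  qed
  moreover have fin: "finite ?L" by (rule finite_lists_length_eq) simp
  ultimately have "card (sparse_translations n r) \<le> card ?L"
    by (meson surj_card_le)
  then show ?thesis by (simp add: card_lists_length_eq)
qed

section \<open>Generalization inside a fenced invariant\<close>

lemma converse_relpow:
  fixes R :: "('a \<times> 'a) set"
  shows "(R\<inverse>) ^^ i = (R ^^ i)\<inverse>"
  by (induction i) (simp_all add: converse_relcomp flip: relpow_commute)

text \<open>Every actual flip lowers the disagreement and nothing raises it, so a pass that ends at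
  \<open>v\<close> never left \<open>v\<close>; each disagreeing index was thus tested at
  \<open>v\<close> itself and rejected.\<close>

lemma gen_fold_fixpoint:
  assumes "fst (fold (gen_step S k a) js (v, c)) = v" and "set js \<subseteq> {..<length v}"
    and "j \<in> set js" and "v ! j \<noteq> a ! j"
  shows "\<not> bmc_safe S k (v[j := a ! j])"
  using assms
proof (induction js arbitrary: c)
  case (Cons i js)
  obtain v' c' where step: "gen_step S k a i (v, c) = (v', c')" by (rule prod.exhaust)
  have fold: "fst (fold (gen_step S k a) js (v', c')) = v"
    using Cons.prems(1) by (simp only: fold_simps step)
  then have "v' = v"
    using gen_step_decreases[of S k a i "(v, c)"] gen_fold_decreases[of S k a js "(v', c')"]
    unfolding step fst_conv by (metis less_asym)
  show ?case
  proof (cases "j = i")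
    case True
    have "v[i := a ! i] \<noteq> v"
      using Cons.prems True by (metis insert_subset lessThan_iff list.simps(15) nth_list_update_eq)
    then show ?thesis
      using step \<open>v' = v\<close> Cons.prems(4) True by (auto simp: Let_def split: if_splits)
  next
    case False
    then show ?thesis
      using Cons.IH[of c'] Cons.prems(2-4) fold \<open>v' = v\<close> by simp
  qed
qed simp

locale fenced_invariant =
  fixes S :: transition_system and n k :: nat and I :: "state set"
  assumes nvars: "nvars S = n"
    and invariant: "inductive_invariant S I"
    and fenced: "backwards_fenced S k I"
begin

lemma length_invariant: "v \<in> I \<Longrightarrow> length v = n"
  using invariant by (auto simp: inductive_invariant_def states_def nvars)

lemma bmc_safe_invariant:
  assumes "v \<in> I" shows "bmc_safe S k v"
proof -
  have "y \<in> I" if "(v, y) \<in> trans_rel S ^^ i" for i y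
    using that assms invariant
    by (induction i arbitrary: y) (auto simp: inductive_invariant_def elim!: relpow_Suc_E, blast)
  then show ?thesis
    using invariant unfolding bmc_safe_def reach_le_def inductive_invariant_def by blast
qed

lemma not_bmc_safe_boundary:
  assumes "x \<in> outer_boundary n I" shows "\<not> bmc_safe S k x"
proof -
  obtain i y where "i \<le> k" "y \<in> bad S" "(y, x) \<in> ((trans_rel S)\<inverse>) ^^ i"
    using assms fenced by (auto simp: backwards_fenced_def nvars reach_le_def)
  then have "(x, y) \<in> trans_rel S ^^ i"
    by (simp add: converse_relpow)
  with \<open>i \<le> k\<close> \<open>y \<in> bad S\<close> show ?thesis by (auto simp: bmc_safe_def reach_le_def)
qed

text \<open>A flip that leaves \<open>I\<close> lands on the outer boundary, where the fence makes
  the bounded check fail; the check thus acts as a membership oracle for \<open>I\<close>.\<close>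

lemma bmc_safe_flip:
  assumes "v \<in> I" "j < n" "v ! j \<noteq> b"
  shows "bmc_safe S k (v[j := b]) \<longleftrightarrow> v[j := b] \<in> I"
proof (cases "v[j := b] \<in> I")
  case False
  have "{i. i < n \<and> v[j := b] ! i \<noteq> v ! i} = {j}"
    using assms length_invariant by (auto simp: nth_list_update)
  then have "v[j := b] \<in> outer_boundary n I"
    using False assms(1) length_invariant[OF assms(1)]
    unfolding outer_boundary_def neighbors_def states_def
    by (intro CollectI conjI bexI[of _ v]) simp_all
  with False show ?thesis using not_bmc_safe_boundary by blast
qed (use bmc_safe_invariant in blast)

text \<open>A loop invariant rather than actual reachability by flips. Its second half ensures that
  \<open>x\<close> satisfies the monotone cube of \<open>v\<close>: where \<open>v\<close> differs
  from \<open>a\<close>, it still equals \<open>x\<close>.\<close>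

definition reaches :: "state \<Rightarrow> state \<Rightarrow> state \<Rightarrow> bool" where
  "reaches a x v \<longleftrightarrow> v \<in> I \<and> (\<forall>j<n. v ! j = x ! j \<or> v ! j = a ! j)"

text \<open>The 4 is the three ticks of a tested index plus the time unit of the check.\<close>

lemma gen_step_reaches:
  assumes "reaches a x (fst vc)" "j < n"
  shows "reaches a x (fst (gen_step S k a j vc))"
    and "snd (gen_step S k a j vc) \<le> snd vc + (0, 1, 4)"
proof -
  obtain v c where vc: "vc = (v, c)" by (cases vc)
  have "reaches a x (v[j := a ! j])" if "bmc_safe S k (v[j := a ! j])" "a ! j \<noteq> v ! j"
    using that assms bmc_safe_flip[of v j "a ! j"] length_invariant[of v]
    by (auto simp: vc reaches_def nth_list_update)
  then show "reaches a x (fst (gen_step S k a j vc))"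
    using assms(1) by (simp add: vc Let_def)
  show "snd (gen_step S k a j vc) \<le> snd vc + (0, 1, 4)"
    by (simp add: vc Let_def ticks_def bmc_check_def less_eq_prod_def)
qed

lemma gen_fold_reaches:
  assumes "reaches a x (fst vc)" "set js \<subseteq> {..<n}"
  shows "reaches a x (fst (fold (gen_step S k a) js vc)) \<and>
    snd (fold (gen_step S k a) js vc) \<le> snd vc + (0, length js, 4 * length js)"
  using assms
proof (induction js arbitrary: vc)
  case (Cons i js)
  let ?vc = "gen_step S k a i vc"
  have step: "reaches a x (fst ?vc)" "snd ?vc \<le> snd vc + (0, 1, 4)"
    using gen_step_reaches[OF Cons.prems(1), of i] Cons.prems(2) by simp_all
  have IH: "reaches a x (fst (fold (gen_step S k a) js ?vc))"
    "snd (fold (gen_step S k a) js ?vc) \<le> snd ?vc + (0, length js, 4 * length js)"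
    using Cons.IH[OF step(1)] Cons.prems(2) by simp_all
  note IH(2)
  also have "snd ?vc + (0, length js, 4 * length js) \<le>
      snd vc + (0, 1, 4) + (0, length js, 4 * length js)"
    using step(2) by (rule add_right_mono)
  also have "\<dots> = snd vc + (0, length (i # js), 4 * length (i # js))"
    by (simp add: add.assoc)
  finally show ?case using IH(1) by simp
qed (simp add: less_eq_prod_def)

text \<open>Every pass that changes the state lowers the disagreement, so there are at most
  \<open>disagreement a v\<close> of them, and one last pass confirms the fixpoint. A pass costs at
  most \<open>n\<close> checks and \<open>4 * n\<close> time, plus one tick for the comparison after
  it.\<close>

lemma gen_loop_reaches:
  assumes "reaches a x v"
  shows "\<exists>w c'. gen_loop S k a (v, c) = (w, c') \<and> reaches a x w \<and> w \<in> local_minima n I a \<and>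
    c' \<le> c + (0, (disagreement a v + 1) * n, (disagreement a v + 1) * (4 * n + 1))"
  using assms
proof (induction "disagreement a v" arbitrary: v c rule: less_induct)
  case less
  obtain v' c' where pass: "gen_pass S k a (v, c) = (v', c')" by (rule prod.exhaust)
  then have fold: "fold (gen_step S k a) [0..<n] (v, c) = (v', c')"
    by (simp add: gen_pass_def nvars)
  have reach: "reaches a x v'" and cost: "c' \<le> c + (0, n, 4 * n)"
    using gen_fold_reaches[of a x "(v, c)" "[0..<n]"] less.prems fold
    by (simp_all add: atLeast0LessThan)
  show ?case
  proof (cases "v' = v")
    case True
    have "\<not> bmc_safe S k (v[j := a ! j])" if "j < n" "v ! j \<noteq> a ! j" for j
      using gen_fold_fixpoint[of S k a "[0..<n]" v c j] fold True that less.prems length_invariant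
      by (auto simp: reaches_def atLeast0LessThan)
    then have "v \<in> local_minima n I a"
      using less.prems bmc_safe_invariant by (auto simp: reaches_def local_minima_def)
    then show ?thesis
      using pass True less.prems cost by (auto simp: ticks_def less_eq_prod_def)
  next
    case False
    then have dec: "disagreement a v' < disagreement a v"
      using gen_fold_decreases[of S k a "[0..<n]" "(v, c)"] fold by simp
    obtain w c'' where w: "gen_loop S k a (v', c' + ticks 1) = (w, c'')"
      "reaches a x w" "w \<in> local_minima n I a"
      and c'': "c'' \<le> c' + ticks 1 +
        (0, (disagreement a v' + 1) * n, (disagreement a v' + 1) * (4 * n + 1))"
      using less.hyps[OF dec reach] by blast
    have "c'' \<le> c + (0, n, 4 * n) + ticks 1 +
        (0, (disagreement a v' + 1) * n, (disagreement a v' + 1) * (4 * n + 1))"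
      using c'' cost by (meson add_right_mono order_trans)
    also have "\<dots> = c + (0, (disagreement a v' + 2) * n, (disagreement a v' + 2) * (4 * n + 1))"
      by (cases c) (simp add: ticks_def algebra_simps)
    also have "\<dots> \<le> c + (0, (disagreement a v + 1) * n, (disagreement a v + 1) * (4 * n + 1))"
      using dec by (intro add_left_mono Pair_mono order_refl mult_le_mono1) simp_all
    finally show ?thesis
      using w pass False by simp
  qed
qed

text \<open>The additional check is the test of \<open>x\<close> itself, which succeeds inside
  \<open>I\<close>; the \<open>2 * n\<close> ticks pay for copying \<open>x\<close> and building the
  cube.\<close>

lemma mon_gen_bmc_invariant:
  assumes "x \<in> I"
  shows "\<exists>v c. mon_gen_bmc S k x a = (Some (monotone_cube a v), c) \<and> v \<in> local_minima n I a \<and>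
    conjunct_holds x (monotone_cube a v) \<and>
    c \<le> (0, 1 + (n + 1) * n, 1 + 2 * n + (n + 1) * (4 * n + 1))"
proof -
  have "reaches a x x" using assms by (simp add: reaches_def)
  from gen_loop_reaches[OF this, of "bmc_check + ticks n"]
  obtain v c where v: "gen_loop S k a (x, bmc_check + ticks n) = (v, c)" "reaches a x v"
      "v \<in> local_minima n I a"
    and c: "c \<le> bmc_check + ticks n +
      (0, (disagreement a x + 1) * n, (disagreement a x + 1) * (4 * n + 1))"
    by blast
  have "disagreement a x \<le> n"
    using card_mono[of "{..<n}" "{j. j < n \<and> x ! j \<noteq> a ! j}"] length_invariant[OF assms]
    by (auto simp: disagreement_def)
  then have "(0, (disagreement a x + 1) * n, (disagreement a x + 1) * (4 * n + 1)) \<le>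
      ((0, (n + 1) * n, (n + 1) * (4 * n + 1)) :: cost)"
    by (intro Pair_mono order_refl mult_le_mono1) simp_all
  then have "c \<le> bmc_check + ticks n + (0, (n + 1) * n, (n + 1) * (4 * n + 1))"
    using c by (meson add_left_mono order_trans)
  then have "c + ticks n \<le> (0, 1 + (n + 1) * n, 1 + 2 * n + (n + 1) * (4 * n + 1))"
    by (auto simp: less_eq_prod_def ticks_def bmc_check_def)
  moreover have "conjunct_holds x (monotone_cube a v)"
    using v(2) length_invariant[of v]
    by (auto simp: conjunct_holds_monotone_cube reaches_def)
  ultimately show ?thesis
    using v bmc_safe_invariant[OF assms] by (auto simp: mon_gen_bmc_def nvars)
qed

end

section \<open>Runs of the inference algorithm\<close>

locale fenced_dnf = fenced_invariant S n k "sat n F"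
  for S :: transition_system and n k :: nat and F :: dnf +
  fixes r :: nat and as :: "state list"
  assumes over: "dnf_over n F"
    and almost: "almost_monotone r F"
    and basis: "set as = sparse_translations n r"
begin

abbreviation I :: "state set" where "I \<equiv> sat n F"

abbreviation m :: nat where "m \<equiv> length F"

definition hyp_size :: nat where
  "hyp_size = 1 + m * (n + 1)"

definition gen_bmc :: nat where
  "gen_bmc = 1 + (n + 1) * n"

definition gen_time :: nat where
  "gen_time = 1 + 2 * n + (n + 1) * (4 * n + 1)"

text \<open>Distinctness turns the bound on the number of local minima into a bound on the length of
  \<open>H\<close>.\<close>

definition sound :: "state \<times> dnf \<Rightarrow> bool" where
  "sound = (\<lambda>(a, H). distinct H \<and> set H \<subseteq> monotone_cube a ` local_minima n I a)"

text \<open>The potential of a run: at most \<open>m\<close> per translation, and raised by every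
  continuing iteration.\<close>

definition cubes :: "hypotheses \<Rightarrow> nat" where
  "cubes Hs = (\<Sum>(a, H)\<leftarrow>Hs. length H)"

lemma sound_length:
  assumes "sound (a, H)" shows "length H \<le> m"
proof -
  have "length H = card (set H)"
    using assms by (simp add: sound_def distinct_card)
  also have "\<dots> \<le> card (monotone_cube a ` local_minima n I a)"
    using assms by (intro card_mono) (auto simp: sound_def finite_local_minima)
  also have "\<dots> \<le> m"
    using card_image_le[OF finite_local_minima] card_local_minima le_trans by blast
  finally show ?thesis .
qed

lemma sound_size:
  assumes "sound (a, H)" shows "1 + dnf_size H \<le> hyp_size"
proof -
  have "1 + length T \<le> n + 1" if "T \<in> set H" for T
    using that assms length_invariant length_monotone_cube
    by (fastforce simp: sound_def local_minima_def)
  then have "dnf_size H \<le> length H * (n + 1)"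
    unfolding dnf_size_def
    by (metis (no_types, lifting) sum_list_mono sum_list_triv of_nat_id)
  also have "\<dots> \<le> m * (n + 1)"
    using sound_length[OF assms] by (rule mult_le_mono1)
  finally show ?thesis by (simp add: hyp_size_def)
qed

lemma sound_cubes: "\<forall>h\<in>set Hs. sound h \<Longrightarrow> cubes Hs \<le> length Hs * m"
  by (induction Hs) (auto simp: cubes_def intro!: add_mono sound_length)

lemma iteration_check_le:
  assumes "\<forall>h\<in>set Hs. sound h"
  shows "iteration_check Hs \<le> (1, 0, 1 + length Hs * hyp_size)"
proof -
  have "(\<Sum>(a, H)\<leftarrow>Hs. 1 + dnf_size H) \<le> length Hs * hyp_size"
    using assms
  proof (induction Hs)
    case (Cons h Hs)
    then show ?case using sound_size[of "fst h" "snd h"] by (auto simp: case_prod_unfold)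
  qed simp
  then show ?thesis
    by (simp add: iteration_check_def inductiveness_check_def ticks_def less_eq_prod_def)
qed

lemma add_cubes_sound:
  assumes "x \<in> I" "\<forall>h\<in>set Hs. sound h"
  shows "\<exists>Hs' c. add_cubes S k x Hs = (Some Hs', c) \<and> map fst Hs' = map fst Hs \<and>
    (\<forall>h\<in>set Hs'. sound h) \<and>
    cubes Hs + of_bool (\<exists>H\<in>snd ` set Hs. \<not> dnf_holds x H) \<le> cubes Hs' \<and>
    c \<le> (0, length Hs * gen_bmc, 1 + length Hs * (hyp_size + gen_time + 1))"
  using assms(2)
proof (induction Hs)
  case Nil
  show ?case by (simp add: ticks_def less_eq_prod_def)
next
  case (Cons h Hs)
  obtain a H where h: "h = (a, H)" by fastforce
  have sound: "sound (a, H)" using Cons.prems h by simp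
  obtain Hs' c where IH: "add_cubes S k x Hs = (Some Hs', c)" "map fst Hs' = map fst Hs"
      "\<forall>h\<in>set Hs'. sound h"
      "cubes Hs + of_bool (\<exists>H\<in>snd ` set Hs. \<not> dnf_holds x H) \<le> cubes Hs'"
      "c \<le> (0, length Hs * gen_bmc, 1 + length Hs * (hyp_size + gen_time + 1))"
    using Cons by auto
  show ?case
  proof (cases "dnf_holds x H")
    case True
    have "ticks (1 + dnf_size H) + 0 + c \<le>
        (0, length (h # Hs) * gen_bmc, 1 + length (h # Hs) * (hyp_size + gen_time + 1))"
      using IH(5) sound_size[OF sound] by (auto simp: ticks_def less_eq_prod_def)
    then show ?thesis
      using True IH sound by (auto simp: h cubes_def)
  next
    case False
    obtain v d where v: "mon_gen_bmc S k x a = (Some (monotone_cube a v), d)"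
        "v \<in> local_minima n I a" "conjunct_holds x (monotone_cube a v)"
      and d: "d \<le> (0, gen_bmc, gen_time)"
      using mon_gen_bmc_invariant[OF assms(1)] unfolding gen_bmc_def gen_time_def by blast
    \<comment> \<open>All cubes in \<open>H\<close> are false at \<open>x\<close> while the new one
      holds there, so distinctness survives.\<close>
    have "monotone_cube a v \<notin> set H"
      using False v(3) by (auto simp: dnf_holds_def)
    then have "sound (a, H @ [monotone_cube a v])"
      using sound v(2) by (auto simp: sound_def)
    moreover have "ticks (1 + dnf_size H) + (d + ticks 1) + c \<le>
        (0, length (h # Hs) * gen_bmc, 1 + length (h # Hs) * (hyp_size + gen_time + 1))"
      using IH(5) sound_size[OF sound] d by (auto simp: ticks_def less_eq_prod_def)
    ultimately show ?thesis
      using False IH v(1) by (auto simp: h cubes_def)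
  qed
qed

text \<open>For \<open>x\<close> outside \<open>I\<close>, \<open>sparse_separation\<close> supplies
  a basis element whose hypothesis, built only from cubes of states of \<open>I\<close>, rejects
  \<open>x\<close>.\<close>

lemma candidate_below_invariant:
  assumes "\<forall>h\<in>set Hs. sound h" "map fst Hs = as"
  shows "conj_sat n (map snd Hs) \<subseteq> I"
proof
  fix x assume x: "x \<in> conj_sat n (map snd Hs)"
  show "x \<in> I"
  proof (rule ccontr)
    assume "x \<notin> I"
    then obtain a where "a \<in> set as" and a: "\<forall>v\<in>I. \<not> conjunct_holds x (monotone_cube a v)"
      using sparse_separation[OF over almost, of x] x basis unfolding conj_sat_def by blast
    then obtain H where H: "(a, H) \<in> set Hs"
      using assms(2) by auto
    then have "dnf_holds x H" using x by (force simp: conj_sat_def)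
    then show False
      using H assms(1) a by (fastforce simp: sound_def dnf_holds_def local_minima_def)
  qed
qed

lemma counterexample_in_invariant:
  assumes "x \<in> counterexamples S H" "H \<subseteq> I" shows "x \<in> I"
  using assms invariant by (auto simp: counterexamples_def inductive_invariant_def)

text \<open>Bounds the cost of \<open>N\<close> iterations. The factor 2 covers assembling the
  candidate and testing the counterexample; the summand 2 is the inductiveness check and the end of
  the list.\<close>

definition step_cost :: "nat \<Rightarrow> cost" where
  "step_cost N = (N, N * (length as * gen_bmc),
     N * (2 + length as * (2 * hyp_size + gen_time + 1)))"

lemma step_cost_mono: "N \<le> N' \<Longrightarrow> step_cost N \<le> step_cost N'"
  by (simp only: step_cost_def less_eq_prod_def fst_conv snd_conv mult_le_mono1 simp_thms)

text \<open>Iterations are charged to the cubes they add. A returned run is allowed one unit beyond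
  the maximal potential, for its final check.\<close>

fun good :: "config \<Rightarrow> bool" where
  "good (Running Hs c) \<longleftrightarrow> (\<forall>h\<in>set Hs. sound h) \<and> map fst Hs = as \<and>
     c \<le> ticks (length as) + step_cost (cubes Hs)"
| "good (Failed c) \<longleftrightarrow> False"
| "good (Returned Hs c) \<longleftrightarrow> inductive_invariant S (conj_sat n Hs) \<and>
     c \<le> ticks (length as) + step_cost (length as * m + 1)"

fun progress :: "config \<Rightarrow> nat" where
  "progress (Running Hs c) = cubes Hs"
| "progress _ = 0"

lemma good_start: "good (lambda_start as)"
  by (auto simp: lambda_start_def sound_def comp_def less_eq_prod_def step_cost_def ticks_def)

text \<open>The counterexample lies in \<open>I\<close> but not in the candidate, so some hypothesis
  must grow; the new cube pays for the iteration.\<close>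

lemma add_cubes_counterexample:
  assumes good: "good (Running Hs c)"
    and x: "x \<in> counterexamples S (conj_sat n (map snd Hs))"
  obtains Hs' c' where "add_cubes S k x Hs = (Some Hs', c')"
    "good (Running Hs' (c + iteration_check Hs + c'))" "cubes Hs < cubes Hs'"
proof -
  have Hs: "\<forall>h\<in>set Hs. sound h" "map fst Hs = as"
    and c: "c \<le> ticks (length as) + step_cost (cubes Hs)"
    using good by auto
  have len: "length Hs = length as" using Hs(2) by (metis length_map)
  have xI: "x \<in> I"
    using counterexample_in_invariant[OF x candidate_below_invariant[OF Hs]] .
  then have "x \<in> states n" by (simp add: sat_def)
  then have ex: "\<exists>H\<in>snd ` set Hs. \<not> dnf_holds x H"
    using x by (auto simp: counterexamples_def conj_sat_def)
  obtain Hs' c' where add: "add_cubes S k x Hs = (Some Hs', c')" "map fst Hs' = map fst Hs"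
      "\<forall>h\<in>set Hs'. sound h"
      "cubes Hs + of_bool (\<exists>H\<in>snd ` set Hs. \<not> dnf_holds x H) \<le> cubes Hs'"
      "c' \<le> (0, length Hs * gen_bmc, 1 + length Hs * (hyp_size + gen_time + 1))"
    using add_cubes_sound[OF xI Hs(1)] by blast
  have less: "cubes Hs < cubes Hs'" using add(4) ex by simp
  have "c + iteration_check Hs + c' \<le> ticks (length as) + step_cost (cubes Hs) +
      (1, 0, 1 + length Hs * hyp_size) +
      (0, length Hs * gen_bmc, 1 + length Hs * (hyp_size + gen_time + 1))"
    by (intro add_mono c iteration_check_le Hs add)
  also have "\<dots> = ticks (length as) + step_cost (cubes Hs + 1)"
    by (simp add: step_cost_def ticks_def len algebra_simps)
  also have "\<dots> \<le> ticks (length as) + step_cost (cubes Hs')"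
    using less by (intro add_left_mono step_cost_mono) simp
  finally show thesis
    using that add less Hs by simp
qed

lemma lambda_step_good:
  assumes "lambda_step S k cfg cfg'" "good cfg"
  shows "good cfg' \<and> ((\<exists>Hs c. cfg' = Running Hs c) \<longrightarrow> progress cfg < progress cfg')"
  using assms
proof cases
  case (lambda_return Hs c)
  have Hs: "\<forall>h\<in>set Hs. sound h" "length Hs = length as"
    and c: "c \<le> ticks (length as) + step_cost (cubes Hs)"
    using assms(2) lambda_return by auto
  have "c + iteration_check Hs \<le>
      ticks (length as) + step_cost (cubes Hs) + (1, 0, 1 + length Hs * hyp_size)"
    by (intro add_mono c iteration_check_le Hs)
  also have "\<dots> \<le> ticks (length as) + step_cost (cubes Hs + 1)"
    by (simp add: step_cost_def ticks_def Hs less_eq_prod_def algebra_simps)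
  also have "\<dots> \<le> ticks (length as) + step_cost (length as * m + 1)"
    using sound_cubes[OF Hs(1)] Hs(2) by (intro add_left_mono step_cost_mono) simp
  finally show ?thesis using lambda_return by (simp add: nvars)
next
  case (lambda_continue Hs x Hs' c' c)
  then show ?thesis
    using add_cubes_counterexample[of Hs c x] assms(2) by (auto simp: nvars)
next
  case (lambda_fail Hs x c' c)
  then show ?thesis
    using add_cubes_counterexample[of Hs c x] assms(2) by (auto simp: nvars)
qed

section \<open>Termination and total cost\<close>

lemma reachable_good:
  "(lambda_step S k)\<^sup>*\<^sup>* (lambda_start as) cfg \<Longrightarrow> good cfg"
  by (induction rule: rtranclp_induct) (use good_start lambda_step_good in blast)+

lemma good_progress: "good cfg \<Longrightarrow> progress cfg \<le> length as * m"
  by (cases cfg) (use sound_cubes in fastforce)+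

lemma good_cost:
  assumes "good cfg"
  shows "config_cost cfg \<le> ticks (length as) + step_cost (length as * m + 1)"
proof (cases cfg)
  case (Running Hs c)
  have "c \<le> ticks (length as) + step_cost (cubes Hs)" using assms Running by simp
  also have "\<dots> \<le> ticks (length as) + step_cost (length as * m + 1)"
    using good_progress[OF assms] Running by (intro add_left_mono step_cost_mono) simp
  finally show ?thesis using Running by simp
qed (use assms in auto)

text \<open>A running candidate lies inside \<open>I\<close>, hence is safe; if it is not an
  invariant, it has a counterexample, on which the loop can continue.\<close>

lemma good_stuck:
  assumes "good cfg" "\<nexists>cfg'. lambda_step S k cfg cfg'"
  shows "\<exists>Hs c. cfg = Returned Hs c \<and> inductive_invariant S (conj_sat n Hs)"
proof (cases cfg)
  case (Running Hs c)
  let ?H = "conj_sat n (map snd Hs)"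
  have noninv: "\<not> inductive_invariant S ?H"
    using assms(2) Running lambda_return[of S Hs k c] nvars by auto
  have "?H \<subseteq> I"
    using candidate_below_invariant assms(1) Running by simp
  moreover have "I \<subseteq> states n" "I \<inter> bad S = {}"
    using invariant by (simp_all add: inductive_invariant_def nvars)
  ultimately have "?H \<subseteq> states n" "?H \<inter> bad S = {}"
    by blast+
  with noninv obtain x where x: "x \<in> counterexamples S ?H"
    by (auto simp: inductive_invariant_def counterexamples_def nvars)
  obtain Hs' c' where "add_cubes S k x Hs = (Some Hs', c')"
    using add_cubes_counterexample[OF _ x] assms(1) Running by blast
  then show ?thesis
    using assms(2) Running noninv x lambda_continue[of S Hs x k Hs' c' c] nvars by auto
qed (use assms in auto)

lemma converges: "lambda_converges S k as"
proof -
  have False if f: "f 0 = lambda_start as" "\<forall>i. lambda_step S k (f i) (f (Suc i))" for f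
  proof -
    have good: "good (f i)" for i
      by (induction i) (use f good_start lambda_step_good in metis)+
    have "i \<le> progress (f i)" for i
    proof (induction i)
      case (Suc i)
      \<comment> \<open>A configuration with a successor is running, so the potential rises at each
        step of an infinite run.\<close>
      have "\<exists>Hs c. f (Suc i) = Running Hs c"
        using spec[OF f(2), of "Suc i"] by (cases rule: lambda_step.cases) auto
      then show ?case
        using lambda_step_good[of "f i" "f (Suc i)"] f(2) good Suc by fastforce
    qed simp
    from this[of "Suc (length as * m)"] good_progress[OF good[of "Suc (length as * m)"]]
    show False by simp
  qed
  moreover have "\<exists>Hs c. cfg = Returned Hs c \<and> inductive_invariant S (conj_sat (nvars S) Hs)"
    if "(lambda_step S k)\<^sup>*\<^sup>* (lambda_start as) cfg" "\<nexists>cfg'. lambda_step S k cfg cfg'" for cfg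
    using good_stuck[OF reachable_good] that nvars by simp
  ultimately show ?thesis unfolding lambda_converges_def by blast
qed

lemma cost_bounded:
  assumes "ticks (length as) + step_cost (length as * m + 1) \<le> (i, b, t)"
  shows "lambda_cost_bounded S k as i b t"
proof -
  have "config_cost cfg \<le> (i, b, t)"
    if "(lambda_step S k)\<^sup>*\<^sup>* (lambda_start as) cfg" for cfg
    using order_trans[OF good_cost[OF reachable_good[OF that]] assms] .
  then show ?thesis
    unfolding lambda_cost_bounded_def by (metis Pair_le)
qed

end

section \<open>Polynomial bounds in \<open>m * n\<close>\<close>

theorem corollary6p11:
  fixes r :: nat
  shows "\<exists>P_ind P_bmc P_time :: nat poly.
    \<forall>(S :: transition_system) (n :: nat) (m :: nat) (k :: nat) (F :: dnf) (as :: state list).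
      is_transition_system S \<and> nvars S = n \<and>
      dnf_over n F \<and> length F = m \<and> almost_monotone r F \<and>
      inductive_invariant S (sat n F) \<and> backwards_fenced S k (sat n F) \<and>
      distinct as \<and> set as = sparse_translations n r \<longrightarrow>
      lambda_converges S k as \<and>
      lambda_cost_bounded S k as
        (poly P_ind (m * n)) (poly P_bmc (m * n)) (poly P_time (m * n))"
proof -
  \<comment> \<open>The polynomials copy \<open>step_cost\<close> with \<open>m\<close> and
    \<open>n\<close> both replaced by \<open>X\<close>, \<open>length as\<close> by
    \<open>T\<close>, and the number of iterations by \<open>P_ind\<close>.\<close>
  define X where "X = ([:0, 1:] :: nat poly)"
  define T where "T = (X + 1) ^ r"
  define P_ind where "P_ind = T * X + 1"
  define P_bmc where "P_bmc = P_ind * (T * (1 + (X + 1) * X))"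
  define P_time where "P_time = T + P_ind * (2 + T * (2 * (1 + X * (X + 1)) +
    (1 + 2 * X + (X + 1) * (4 * X + 1)) + 1))"
  have "lambda_converges S k as \<and>
      lambda_cost_bounded S k as
        (poly P_ind (m * n)) (poly P_bmc (m * n)) (poly P_time (m * n))"
    if ts: "is_transition_system S" and nvars: "nvars S = n"
      and F: "dnf_over n F" "length F = m" "almost_monotone r F"
      and inv: "inductive_invariant S (sat n F)" and fence: "backwards_fenced S k (sat n F)"
      and as: "distinct as" "set as = sparse_translations n r"
    for S n m k F as
  proof -
    interpret fenced_dnf S n k F r as
      by unfold_locales (use nvars F inv fence as in auto)
    define s where "s = m * n"
    \<comment> \<open>Neither factor vanishes, so each is at most \<open>m * n\<close>: with no
      variables there is a single state, and \<open>bad S\<close> would be empty or everything; with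
      no terms the invariant could not contain \<open>init S\<close>.\<close>
    have "n \<noteq> 0"
    proof
      assume "n = 0"
      then have "states (nvars S) = {[]}" using nvars by (auto simp: states_def)
      then show False using ts by (auto simp: is_transition_system_def)
    qed
    moreover have "m \<noteq> 0"
      using ts inv F(2) by (auto simp: is_transition_system_def inductive_invariant_def sat_def dnf_holds_def)
    ultimately have s: "m \<le> s" "n \<le> s" by (auto simp: s_def)
    have "length as \<le> (n + 1) ^ r"
      using card_sparse_translations[of n r] as distinct_card by metis
    also have "\<dots> \<le> (s + 1) ^ r"
      using s by (intro power_mono) auto
    finally have t: "length as \<le> (s + 1) ^ r" .
    have X: "poly X s = s" by (simp add: X_def)
    have "ticks (length as) + step_cost (length as * length F + 1) \<le>
        (poly P_ind s, poly P_bmc s, poly P_time s)"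
      unfolding step_cost_def ticks_def hyp_size_def gen_bmc_def gen_time_def F(2)
        P_ind_def P_bmc_def P_time_def T_def
      by (simp only: less_eq_prod_def fst_add snd_add fst_conv snd_conv poly_add poly_mult poly_power
          poly_1 poly_numeral X add_0, intro conjI)
        (intro add_mono mult_le_mono order_refl t s)+
    then show ?thesis
      using converges cost_bounded by (simp add: s_def)
  qed
  then show ?thesis by blast
qed

end
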